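(* For every integer $n\ge 0$ let $P_n=P_n(q)=\sum_{j\ge 0} q^{j^2}\begin{bmatrix} n\\ j\end{bmatrix}_{q^2}$. Then $$P_n=\sum_{j=-\infty}^\infty (-1)^j q^{2j^2}\begin{bmatrix} 2n\\ n+2j\end{bmatrix}_{q}=\sum_{j=-\infty}^\infty (-1)^j q^{3j^2+j}\,U(n,3j;q)=(-q;q^2)_n,$$ and the polynomials satisfy $P_0=1$ and $P_n=(1+q^{2n-1})P_{n-1}$ for $n\ge 1$.
   Context: $q$ is an indeterminate. $(a;p)_n=\prod_{i=0}^{n-1}(1-ap^i)$. The Gaussian polynomial in base $p$ is $\begin{bmatrix} A\\ B\end{bmatrix}_{p}=\frac{(p;p)_A}{(p;p)_B(p;p)_{A-B}}$ if $0\le B\le A$, and $0$ otherwise. For integers $L\ge0$ and $A$, $$T_0(L,A;q)=\sum_{r=0}^L(-1)^r\begin{bmatrix} L\\ r\end{bmatrix}_{q^2}\begin{bmatrix} 2L-2r\\ L-A-r\end{bmatrix}_{q},\qquad U(L,A;q)=T_0(L,A;q)+T_0(L,A+1;q).$$ All sums have only finitely many nonzero terms. *)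

theory Defs
  imports
    "HOL-Computational_Algebra.Polynomial_Factorial"
    "HOL-Library.Groups_Big_Fun"
begin

text \<open>
  Identities in the indeterminate \<open>q\<close> are read in the field \<open>\<rat>(q)\<close>, realised as the fraction field
  of \<open>\<int>[q]\<close>.
\<close>

type_synonym ratfun = "int poly fract"

definition qq :: ratfun where
  "qq = to_fract [:0, 1:]"

definition qpoch :: "'a::comm_ring_1 \<Rightarrow> 'a \<Rightarrow> nat \<Rightarrow> 'a" where
  "qpoch a p n = (\<Prod>i<n. 1 - a * p ^ i)"

text \<open>
  The quotient below is the intended one only when \<open>p\<close> is not a root of unity; the theorem uses
  \<open>p = qq\<close> and \<open>p = qq ^ 2\<close>.
\<close>

definition gauss :: "'a::field \<Rightarrow> int \<Rightarrow> int \<Rightarrow> 'a" where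
  "gauss p A B =
     (if 0 \<le> B \<and> B \<le> A
      then qpoch p p (nat A) / (qpoch p p (nat B) * qpoch p p (nat (A - B)))
      else 0)"

definition T0 :: "nat \<Rightarrow> int \<Rightarrow> 'a::field \<Rightarrow> 'a" where
  "T0 L A q =
     (\<Sum>r=0..L. (-1) ^ r * gauss (q ^ 2) (int L) (int r)
                  * gauss q (2 * int L - 2 * int r) (int L - A - int r))"

definition U :: "nat \<Rightarrow> int \<Rightarrow> 'a::field \<Rightarrow> 'a" where
  "U L A q = T0 L A q + T0 L (A + 1) q"

text \<open>
  Infinite sums with finitely many nonzero terms are rendered by \<^const>\<open>Sum_any\<close>, which returns
  \<open>0\<close> on a family of infinite support.
\<close>

definition P :: "nat \<Rightarrow> 'a::field \<Rightarrow> 'a" where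
  "P n q = Sum_any (\<lambda>j::nat. q ^ (j ^ 2) * gauss (q ^ 2) (int n) (int j))"

end

theory Submission
  imports Defs
begin

text \<open>
  Each of the four expressions equals \<open>1\<close> at \<open>n = 0\<close> and is multiplied by \<open>1 + q ^ (2 * n + 1)\<close> when
  \<open>n\<close> grows to \<open>n + 1\<close>; this gives all equalities at once, and the recurrence for \<open>P\<close> is itself the
  last claim. For the product there is nothing to prove, and for \<open>P\<close> the recurrence is the Pascal rule
  in base \<open>q\<^sup>2\<close> (\<open>P_Suc\<close>).

  For the two alternating sums the idea is that their summands obey the same recurrence up to a
  difference \<open>h j - h (j - 1)\<close> of a finitely supported \<open>h\<close>, which vanishes on summation over all
  integers (\<open>Sum_any_telescope\<close>). For the first sum the recurrence of the summands comes from applying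
  the Pascal rules twice to the central binomials \<open>[2M; M + A]\<close> (\<open>cbin_Suc\<close>). The neighbours \<open>A - 1\<close> and
  \<open>A + 1\<close> enter with weights \<open>q\<^bsup>M+1-A\<^esup>\<close> and \<open>q\<^bsup>M+1+A\<^esup>\<close>; with \<open>A = 2j\<close> and the weight \<open>(-1)\<^sup>j q\<^bsup>2j\<^sup>2\<^esup>\<close>
  these are exactly the two ends of a telescoping difference.

  For the second sum the analogous step (\<open>U_Suc\<close>) is
  \<open>U(N+1,A) = (1 + q\<^bsup>2N+1\<^esup>) U(N,A) + q\<^bsup>N+1-A\<^esup> T\<^sub>1(N,A-1) + q\<^bsup>N+2+A\<^esup> T\<^sub>1(N,A+2)\<close>, where \<open>T\<^sub>1\<close> is the companion
  of \<open>T\<^sub>0\<close> with \<open>-1\<close> replaced by \<open>-q\<close>. At \<open>A = 3j\<close> the arguments are \<open>3j - 1 = 3(j - 1) + 2\<close> and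
  \<open>3j + 2\<close>, so the extra terms again telescope against \<open>(-1)\<^sup>j q\<^bsup>3j\<^sup>2+j\<^esup>\<close>. The recurrence is not valid
  summand by summand in the sum over \<open>M\<close> that defines \<open>U\<close>: the discrepancy contains the factor
  \<open>1 - q\<^bsup>2(N-M)\<^esup>\<close>, which moves the index \<open>M\<close> by one in the binomial in base \<open>q\<^sup>2\<close> (\<open>sum_wt_shift\<close>), and
  after this shift all reduces to a contiguous relation between two successive rows of central
  binomials (\<open>cbin_contiguous\<close>).
\<close>

section \<open>Gaussian binomials at a non-root of unity\<close>

text \<open>
  This is what keeps all denominators in \<^const>\<open>gauss\<close> nonzero; \<open>p \<noteq> 0\<close> makes integer powers of \<open>p\<close>
  add their exponents.
\<close>

definition generic :: "'a::field \<Rightarrow> bool" where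
  "generic p \<longleftrightarrow> p \<noteq> 0 \<and> (\<forall>n>0. p ^ n \<noteq> 1)"

lemma generic_square: "generic q \<Longrightarrow> generic (q ^ 2)"
  by (auto simp: generic_def simp flip: power_mult)

lemma generic_qq: "generic qq"
proof -
  have pow: "qq ^ n = to_fract (monom 1 n)" for n
    by (induction n) (auto simp: qq_def monom_Suc mult.commute simp flip: to_fract_mult)
  have "monom (1::int) n \<noteq> 1" if "n > 0" for n
    using that by (metis degree_1 degree_monom_eq less_irrefl zero_neq_one)
  moreover have "qq \<noteq> 0"
    by (simp add: qq_def)
  ultimately show ?thesis
    unfolding generic_def pow by (metis to_fract_1 to_fract_eq_iff)
qed

lemma qpoch_Suc: "qpoch p p (Suc n) = qpoch p p n * (1 - p ^ Suc n)"
  by (simp add: qpoch_def)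

lemma qpoch_nonzero: "generic p \<Longrightarrow> qpoch p p n \<noteq> 0"
  by (induction n) (simp add: qpoch_def, auto simp: qpoch_Suc generic_def simp del: power_Suc)

lemma gauss_sym: "gauss p N (N - k) = gauss p N k"
  by (auto simp: gauss_def mult.commute)

lemma gauss_zero: "gauss p 0 k = (if k = 0 then 1 else 0)"
  by (auto simp: gauss_def qpoch_def)

text \<open>
  The absorption rules hold for all integers \<open>N\<close> and \<open>k\<close>: outside \<open>1 \<le> k \<le> N\<close> both sides vanish, either
  because of a binomial or because of a factor \<open>1 - p\<^sup>0\<close>. Both Pascal rules follow from them, through
  \<open>1 - p\<^sup>N = (1 - p\<^sup>k) + p\<^sup>k (1 - p\<^bsup>N-k\<^esup>)\<close>, without any boundary cases beyond \<open>N > 0\<close>.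
\<close>

lemma gauss_absorb:
  assumes "generic p"
  shows "(1 - p powi k) * gauss p N k = (1 - p powi N) * gauss p (N - 1) (k - 1)"
proof (cases "1 \<le> k \<and> k \<le> N")
  case True
  define m where "m = nat (k - 1)"
  define d where "d = nat (N - k)"
  have k: "k = int (Suc m)" and N: "N = int (Suc (m + d))"
    using True by (auto simp: m_def d_def)
  have "p ^ Suc m \<noteq> 1"
    using assms by (auto simp: generic_def simp del: power_Suc)
  moreover have "nat (int (Suc (m + d)) - int (Suc m)) = d" by simp
  moreover have g: "gauss p N k = qpoch p p (Suc (m+d)) / (qpoch p p (Suc m) * qpoch p p d)"
    unfolding gauss_def k N by (simp add: nat_add_distrib)
  moreover have g': "gauss p (N-1) (k-1) = qpoch p p (m+d) / (qpoch p p m * qpoch p p d)"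
    unfolding gauss_def k N by (simp add: nat_add_distrib)
  ultimately show ?thesis
    using qpoch_nonzero[OF assms] unfolding g g'
    unfolding k N power_int_of_nat qpoch_Suc
    by (simp add: field_simps)
qed (auto simp: gauss_def)

lemma gauss_absorb':
  assumes "generic p"
  shows "(1 - p powi (N - k)) * gauss p N k = (1 - p powi N) * gauss p (N - 1) k"
  using gauss_absorb[OF assms, of "N - k" N] gauss_sym[of p N k] gauss_sym[of p "N - 1" k]
  by (simp add: algebra_simps)

lemma one_minus_powi_nonzero:
  assumes "generic p" "N > 0"
  shows "1 - p powi N \<noteq> 0"
  using assms by (auto simp: generic_def power_int_def)

lemma gauss_pascal:
  assumes "generic p" "N > 0"
  shows "gauss p N k = gauss p (N - 1) (k - 1) + p powi k * gauss p (N - 1) k"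
proof -
  have "p \<noteq> 0" using assms by (simp add: generic_def)
  then have "p powi k * p powi (N - k) = p powi N"
    by (simp flip: power_int_add)
  then have "(1 - p powi N) * gauss p N k
      = (1 - p powi k) * gauss p N k + p powi k * ((1 - p powi (N - k)) * gauss p N k)"
    by (simp add: algebra_simps)
  also have "\<dots> = (1 - p powi N) * (gauss p (N - 1) (k - 1) + p powi k * gauss p (N - 1) k)"
    unfolding gauss_absorb[OF assms(1)] gauss_absorb'[OF assms(1)] by (simp add: algebra_simps)
  finally show ?thesis
    using one_minus_powi_nonzero[OF assms] by simp
qed

lemma gauss_pascal':
  assumes "generic p" "N > 0"
  shows "gauss p N k = gauss p (N - 1) k + p powi (N - k) * gauss p (N - 1) (k - 1)"
  using gauss_pascal[OF assms, of "N - k"] gauss_sym[of p N k] gauss_sym[of p "N - 1" k]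
    gauss_sym[of p "N - 1" "k - 1"]
  by (simp add: algebra_simps)

section \<open>Central Gaussian binomials\<close>

definition cbin :: "'a::field \<Rightarrow> nat \<Rightarrow> int \<Rightarrow> 'a" where
  "cbin q M A = gauss q (2 * int M) (int M + A)"

lemma cbin_0: "cbin q 0 A = (if A = 0 then 1 else 0)"
  by (simp add: cbin_def gauss_zero)

lemma cbin_eq_0: "\<bar>A\<bar> > int M \<Longrightarrow> cbin q M A = 0"
  by (auto simp: cbin_def gauss_def)

text \<open>
  One application of the first Pascal rule, then the second one on both terms. The value at \<open>A\<close> is
  reached along two paths, of weights \<open>1\<close> and \<open>q\<^bsup>M+1+A\<^esup> q\<^bsup>M-A\<^esup> = q\<^bsup>2M+1\<^esup>\<close>.
\<close>

lemma cbin_Suc: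
  assumes "generic q"
  shows "cbin q (Suc M) A = (1 + q ^ (2 * M + 1)) * cbin q M A
           + q powi (int M + 1 - A) * cbin q M (A - 1) + q powi (int M + 1 + A) * cbin q M (A + 1)"
proof -
  have q: "q \<noteq> 0" using assms by (simp add: generic_def)
  define m where "m = int M"
  have e: "q powi (m + 1 + A) * q powi (m - A) = q ^ (2 * M + 1)"
    using q by (simp add: m_def ac_simps flip: power_int_add power_int_of_nat)
  have "cbin q (Suc M) A
      = gauss q (2 * m + 1) (m + A) + q powi (m + 1 + A) * gauss q (2 * m + 1) (m + 1 + A)"
    using gauss_pascal[OF assms, of "2 * m + 2" "m + 1 + A"]
    by (simp add: cbin_def m_def algebra_simps)
  also have "gauss q (2 * m + 1) (m + A) = cbin q M A + q powi (m + 1 - A) * cbin q M (A - 1)"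
    using gauss_pascal'[OF assms, of "2 * m + 1" "m + A"]
    by (simp add: cbin_def m_def algebra_simps)
  also have "gauss q (2 * m + 1) (m + 1 + A) = cbin q M (A + 1) + q powi (m - A) * cbin q M A"
    using gauss_pascal'[OF assms, of "2 * m + 1" "m + 1 + A"]
    by (simp add: cbin_def m_def algebra_simps)
  also have "cbin q M A + q powi (m + 1 - A) * cbin q M (A - 1)
      + q powi (m + 1 + A) * (cbin q M (A + 1) + q powi (m - A) * cbin q M A)
    = (1 + q powi (m + 1 + A) * q powi (m - A)) * cbin q M A
      + q powi (m + 1 - A) * cbin q M (A - 1) + q powi (m + 1 + A) * cbin q M (A + 1)"
    by (simp add: algebra_simps)
  finally show ?thesis unfolding e by (simp add: m_def)
qed

lemma mult_one_minus:
  "x * y = z \<Longrightarrow> x * ((1 - y) * c) = x * c - z * c" for x :: "'a::comm_ring_1"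
  by (simp add: algebra_simps)

text \<open>
  The left side is a combination of \<open>(1 - q\<^bsup>M+1+A\<^esup>) [2M+2; M+1+A]\<close> and \<open>(1 - q\<^bsup>M-A\<^esup>) [2M+2; M+2+A]\<close>.
  Absorption turns each into \<open>1 - q\<^bsup>2M+2\<^esup>\<close> times a binomial with top \<open>2M + 1\<close>, and one Pascal step
  brings those down to the top \<open>2M\<close>.
\<close>

lemma cbin_contiguous:
  assumes "generic q"
  shows "q powi (int M + 2 + A) * cbin q (Suc M) (A + 1) + q powi (int M + 1 - A) * cbin q (Suc M) A
           - q ^ (2 * Suc M) * (cbin q (Suc M) A + cbin q (Suc M) (A + 1))
         = (1 - q ^ (2 * Suc M)) *
             (q ^ (2 * M + 1) * (cbin q M A + cbin q M (A + 1))
              + q powi (int M + 1 - A) * cbin q M (A - 1) + q powi (int M + 2 + A) * cbin q M (A + 2))"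
proof -
  have q: "q \<noteq> 0" using assms by (simp add: generic_def)
  define m where "m = int M"
  define G where "G = gauss q (2 * m + 1)"
  have Q: "q ^ (2 * Suc M) = q powi (2 * m + 2)" "q ^ (2 * M + 1) = q powi (2 * m + 1)"
    by (simp_all add: m_def algebra_simps flip: power_int_of_nat)
  have e: "q powi (m + 2 + A) * q powi (m - A) = q powi (2 * m + 2)"
      "q powi (m + 1 - A) * q powi (m + 1 + A) = q powi (2 * m + 2)"
      "q powi (m + 2 + A) * q powi (m - A - 1) = q powi (2 * m + 1)"
      "q powi (m + 1 - A) * q powi (m + A) = q powi (2 * m + 1)"
    using q by (simp_all add: algebra_simps flip: power_int_add)
  have a1: "(1 - q powi (m + 1 + A)) * cbin q (Suc M) A = (1 - q powi (2 * m + 2)) * G (m + A)"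
    using gauss_absorb[OF assms, of "m + 1 + A" "2 * m + 2"]
    by (simp add: cbin_def m_def G_def algebra_simps)
  have a2: "(1 - q powi (m - A)) * cbin q (Suc M) (A + 1)
      = (1 - q powi (2 * m + 2)) * G (m + A + 2)"
    using gauss_absorb'[OF assms, of "2 * m + 2" "m + 2 + A"]
    by (simp add: cbin_def m_def G_def algebra_simps)
  have p1: "G (m + A) = cbin q M (A - 1) + q powi (m + A) * cbin q M A"
    using gauss_pascal[OF assms, of "2 * m + 1" "m + A"]
    by (simp add: cbin_def m_def G_def algebra_simps)
  have p2: "G (m + A + 2) = cbin q M (A + 2) + q powi (m - A - 1) * cbin q M (A + 1)"
    using gauss_pascal'[OF assms, of "2 * m + 1" "m + A + 2"]
    by (simp add: cbin_def m_def G_def algebra_simps)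
  have "q powi (m + 2 + A) * cbin q (Suc M) (A + 1) + q powi (m + 1 - A) * cbin q (Suc M) A
           - q powi (2 * m + 2) * (cbin q (Suc M) A + cbin q (Suc M) (A + 1))
      = q powi (m + 1 - A) * ((1 - q powi (m + 1 + A)) * cbin q (Suc M) A)
        + q powi (m + 2 + A) * ((1 - q powi (m - A)) * cbin q (Suc M) (A + 1))"
    unfolding mult_one_minus[OF e(1)] mult_one_minus[OF e(2)] by (simp add: algebra_simps)
  also have "\<dots> = (1 - q powi (2 * m + 2)) *
      (q powi (m + 1 - A) * G (m + A) + q powi (m + 2 + A) * G (m + A + 2))"
    unfolding a1 a2 by (simp add: algebra_simps)
  also have "q powi (m + 1 - A) * G (m + A) + q powi (m + 2 + A) * G (m + A + 2)
      = q powi (2 * m + 1) * (cbin q M A + cbin q M (A + 1))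
              + q powi (m + 1 - A) * cbin q M (A - 1) + q powi (m + 2 + A) * cbin q M (A + 2)"
    unfolding p1 p2 distrib_left mult.assoc[symmetric] e(3,4) by (simp add: ac_simps)
  finally show ?thesis unfolding Q m_def .
qed

section \<open>Recurrence for U\<close>

text \<open>
  The outer weight of \<open>T\<^sub>0\<close> after the reversal \<open>r = N - M\<close>. The sign is written \<open>(-1)\<^bsup>N+M\<^esup>\<close> rather than
  \<open>(-1)\<^bsup>N-M\<^esup>\<close> so that it makes sense for \<open>M > N\<close>, where the weight vanishes.
\<close>

definition wt :: "'a::field \<Rightarrow> nat \<Rightarrow> nat \<Rightarrow> 'a" where
  "wt q N M = (-1) ^ (N + M) * gauss (q ^ 2) (int N) (int M)"

lemma wt_eq_0: "M > N \<Longrightarrow> wt q N M = 0"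
  by (simp add: wt_def gauss_def)

lemma wt_Suc_0: "generic q \<Longrightarrow> wt q (Suc N) 0 = - wt q N 0"
  using qpoch_nonzero[OF generic_square, of q]
  by (simp add: wt_def gauss_def qpoch_def)

lemma powi_square: "(q ^ 2) powi k = (q::'a::field) powi (2 * k)"
  by (simp add: power_int_mult)

lemma wt_Suc_Suc:
  assumes "generic q"
  shows "wt q (Suc N) (Suc M) = wt q N M - q ^ (2 * Suc M) * wt q N (Suc M)"
proof -
  have "(q ^ 2) powi (int (Suc M)) = q ^ (2 * Suc M)"
    unfolding power_int_of_nat by (simp only: power_mult)
  then show ?thesis
    using gauss_pascal[OF generic_square[OF assms], of "int (Suc N)" "int (Suc M)"]
    by (simp add: wt_def algebra_simps)
qed

text \<open>
  Both sides equal, up to sign, \<open>1 - q\<^bsup>2N\<^esup>\<close> times \<open>[N-1; M]\<close> in base \<open>q\<^sup>2\<close>, by the two absorption rules.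
\<close>

lemma wt_shift:
  assumes "generic q" "M < N"
  shows "(1 - q ^ (2 * (N - M))) * wt q N M = - (1 - q ^ (2 * Suc M)) * wt q N (Suc M)"
proof -
  have "(q ^ 2) powi (int (Suc M)) = q ^ (2 * Suc M)"
    "(q ^ 2) powi (int N - int M) = q ^ (2 * (N - M))"
    using assms by (simp_all only: power_int_of_nat power_mult of_nat_diff[symmetric] less_imp_le)
  then have "(1 - q ^ (2 * (N - M))) * gauss (q ^ 2) (int N) (int M)
      = (1 - q ^ (2 * Suc M)) * gauss (q ^ 2) (int N) (int (Suc M))"
    using gauss_absorb[OF generic_square[OF assms(1)], of "int (Suc M)" "int N"]
      gauss_absorb'[OF generic_square[OF assms(1)], of "int N" "int M"]
    by simp
  moreover have "(-1::'a) ^ (N + Suc M) = - ((-1) ^ (N + M))"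
    by simp
  ultimately show ?thesis
    unfolding wt_def by (simp only: mult.left_commute mult_minus_left mult_minus_right minus_minus)
qed

text \<open>
  Summation by parts with the Pascal rule: raising \<open>N\<close> in the weights amounts to a first-order
  \<open>q\<close>-difference of the summands.
\<close>

lemma sum_wt_Suc:
  assumes "generic q"
  shows "(\<Sum>M\<le>Suc N. wt q (Suc N) M * f M)
       = (\<Sum>M\<le>N. wt q N M * (f (Suc M) - q ^ (2 * M) * f M))"
proof -
  have "(\<Sum>M\<le>Suc N. wt q (Suc N) M * f M)
      = (\<Sum>M\<le>N. wt q N M * f (Suc M))
        - (wt q N 0 * f 0 + (\<Sum>M\<le>N. q ^ (2 * Suc M) * wt q N (Suc M) * f (Suc M)))"
    unfolding sum.atMost_Suc_shift
    by (simp only: wt_Suc_0[OF assms] wt_Suc_Suc[OF assms] left_diff_distrib sum_subtractf) simp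
  also have "wt q N 0 * f 0 + (\<Sum>M\<le>N. q ^ (2 * Suc M) * wt q N (Suc M) * f (Suc M))
      = (\<Sum>M\<le>Suc N. q ^ (2 * M) * wt q N M * f M)"
    unfolding sum.atMost_Suc_shift by simp
  also have "\<dots> = (\<Sum>M\<le>N. q ^ (2 * M) * wt q N M * f M)"
    by (simp add: wt_eq_0)
  finally show ?thesis
    by (simp add: right_diff_distrib sum_subtractf mult_ac)
qed

text \<open>
  A factor \<open>1 - q\<^bsup>2(N-M)\<^esup>\<close> moves the weight from \<open>M\<close> to \<open>M + 1\<close> and changes its sign. This is the means to
  cancel terms that belong to different values of \<open>M\<close>.
\<close>

lemma sum_wt_shift:
  assumes "generic q" and "D 0 = 0" and "\<And>M. D (Suc M) = (1 - q ^ (2 * Suc M)) * C M"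
  shows "(\<Sum>M\<le>N. wt q N M * ((1 - q ^ (2 * (N - M))) * C M + D M)) = 0"
proof -
  have "(\<Sum>M\<le>N. wt q N M * ((1 - q ^ (2 * (N - M))) * C M))
      = (\<Sum>M<N. wt q N M * ((1 - q ^ (2 * (N - M))) * C M))"
    by (simp flip: lessThan_Suc_atMost)
  also have "\<dots> = (\<Sum>M<N. - (wt q N (Suc M) * D (Suc M)))"
  proof (intro sum.cong refl)
    fix M assume "M \<in> {..<N}"
    then have "(1 - q ^ (2 * (N - M))) * wt q N M * C M
        = - (1 - q ^ (2 * Suc M)) * wt q N (Suc M) * C M"
      by (simp only: wt_shift[OF assms(1)] lessThan_iff)
    then show "wt q N M * ((1 - q ^ (2 * (N - M))) * C M) = - (wt q N (Suc M) * D (Suc M))"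
      unfolding assms(3) by (simp only: ac_simps mult_minus_left mult_minus_right)
  qed
  also have "\<dots> = - (\<Sum>M\<le>N. wt q N M * D M)"
    by (simp add: sum.atMost_shift assms(2) sum_negf)
  finally show ?thesis
    by (simp add: distrib_left sum.distrib)
qed

lemma T0_conv_wt: "T0 N A q = (\<Sum>M\<le>N. wt q N M * cbin q M A)"
proof -
  have "T0 N A q = (\<Sum>M\<le>N. (-1) ^ (N - M) * gauss (q ^ 2) (int N) (int (N - M))
                  * gauss q (2 * int N - 2 * int (N - M)) (int N - A - int (N - M)))"
    unfolding T0_def atLeast0AtMost
    by (rule sum.reindex_bij_witness[of _ "\<lambda>r. N - r" "\<lambda>r. N - r"]) auto
  also have "\<dots> = (\<Sum>M\<le>N. wt q N M * cbin q M A)"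
  proof (intro sum.cong refl)
    fix M assume "M \<in> {..N}"
    then have M: "int (N - M) = int N - int M" and s: "(-1::'a) ^ (N - M) = (-1) ^ (N + M)"
      by (auto simp: minus_one_power_iff)
    have "gauss q (2 * int M) (int M - A) = cbin q M A"
      unfolding cbin_def by (subst gauss_sym[symmetric]) simp
    then show "(-1) ^ (N - M) * gauss (q ^ 2) (int N) (int (N - M))
        * gauss q (2 * int N - 2 * int (N - M)) (int N - A - int (N - M)) = wt q N M * cbin q M A"
      unfolding M s gauss_sym wt_def by simp
  qed
  finally show ?thesis .
qed

text \<open>
  The polynomial \<open>T\<^sub>1(N,A) = \<Sum>\<^sub>r (-q)\<^sup>r [N; r] [2N-2r; N-A-r]\<close> of Andrews and Baxter, with the first
  binomial in base \<open>q\<^sup>2\<close>, written in terms of \<open>M = N - r\<close>.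
\<close>

definition T1 :: "nat \<Rightarrow> int \<Rightarrow> 'a::field \<Rightarrow> 'a" where
  "T1 N A q = (\<Sum>M\<le>N. wt q N M * (q ^ (N - M) * cbin q M A))"

lemma T0_eq_0: "\<bar>A\<bar> > int N \<Longrightarrow> T0 N A q = 0"
  unfolding T0_conv_wt by (intro sum.neutral) (auto simp: cbin_eq_0)

lemma T1_eq_0: "\<bar>A\<bar> > int N \<Longrightarrow> T1 N A q = 0"
  unfolding T1_def by (intro sum.neutral) (auto simp: cbin_eq_0)

lemma U_conv_wt: "U N A q = (\<Sum>M\<le>N. wt q N M * (cbin q M A + cbin q M (A + 1)))"
  by (simp add: U_def T0_conv_wt distrib_left sum.distrib)

text \<open>
  By \<open>sum_wt_Suc\<close>, the left side is a sum over \<open>M\<close> of \<open>b (M + 1) - q\<^bsup>2M\<^esup> b M\<close>, where \<open>b\<close> is the inner sum of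
  two central binomials. Expanding \<open>b (M + 1)\<close> by \<open>cbin_Suc\<close> and subtracting the summand of the right
  side leaves \<open>(1 - q\<^bsup>2(N-M)\<^esup>) C M + D M\<close>. Here \<open>C\<close> collects the terms whose power of \<open>q\<close> differs between
  the two sides: the ratio is \<open>q\<^bsup>2(N-M)\<^esup>\<close> for all three. The rest is \<open>D\<close>, and \<open>cbin_contiguous\<close> says
  that \<open>C\<close> and \<open>D\<close> cancel after a shift of \<open>M\<close>.
\<close>

lemma U_Suc:
  assumes "generic q"
  shows "U (Suc N) A q = (1 + q ^ (2 * N + 1)) * U N A q
           + q powi (int N + 1 - A) * T1 N (A - 1) q + q powi (int N + 2 + A) * T1 N (A + 2) q"
proof -
  have q: "q \<noteq> 0" using assms by (simp add: generic_def)
  define b where "b = (\<lambda>M. cbin q M A + cbin q M (A + 1))"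
  define C where "C = (\<lambda>M. q ^ (2 * M + 1) * b M
      + q powi (int M + 1 - A) * cbin q M (A - 1) + q powi (int M + 2 + A) * cbin q M (A + 2))"
  define D where "D = (\<lambda>M. q powi (int M + 1 + A) * cbin q M (A + 1)
      + q powi (int M - A) * cbin q M A - q ^ (2 * M) * b M)"
  have "A + 1 = 0 \<longleftrightarrow> A = -1"
    by presburger
  then have "D 0 = 0"
    by (auto simp: D_def b_def cbin_0)
  moreover have "D (Suc M) = (1 - q ^ (2 * Suc M)) * C M" for M
    using cbin_contiguous[OF assms, of M A] by (simp add: D_def C_def b_def algebra_simps)
  ultimately have zero: "(\<Sum>M\<le>N. wt q N M * ((1 - q ^ (2 * (N - M))) * C M + D M)) = 0"
    by (rule sum_wt_shift[OF assms])
  have "U (Suc N) A q = (\<Sum>M\<le>N. wt q N M * (b (Suc M) - q ^ (2 * M) * b M))"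
    unfolding U_conv_wt sum_wt_Suc[OF assms] b_def ..
  also have "\<dots> = (\<Sum>M\<le>N. wt q N M * ((1 - q ^ (2 * (N - M))) * C M + D M)
      + ((1 + q ^ (2 * N + 1)) * (wt q N M * b M)
      + q powi (int N + 1 - A) * (wt q N M * (q ^ (N - M) * cbin q M (A - 1)))
      + q powi (int N + 2 + A) * (wt q N M * (q ^ (N - M) * cbin q M (A + 2)))))"
  proof (intro sum.cong refl)
    fix M assume "M \<in> {..N}"
    then obtain d where N: "N = M + d"
      by (auto simp: le_iff_add)
    have b: "b (Suc M) = (1 + q ^ (2 * M + 1)) * b M
        + q powi (int M + 1 - A) * cbin q M (A - 1) + q powi (int M + 1 + A) * cbin q M (A + 1)
        + q powi (int M - A) * cbin q M A + q powi (int M + 2 + A) * cbin q M (A + 2)"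
      unfolding b_def cbin_Suc[OF assms] by (simp add: algebra_simps)
    have e: "q powi (int N + 1 - A) = q powi (int M + 1 - A) * q ^ d"
      "q powi (int N + 2 + A) = q powi (int M + 2 + A) * q ^ d"
      using q by (simp_all add: N algebra_simps flip: power_int_add power_int_of_nat)
    have e2: "q ^ (2 * (N - M)) = q ^ d * q ^ d" "q ^ (N - M) = q ^ d"
       "q ^ (2 * N + 1) = q ^ (2 * M + 1) * (q ^ d * q ^ d)"
      by (simp_all add: N mult_2 power_add)
    show "wt q N M * (b (Suc M) - q ^ (2 * M) * b M)
        = wt q N M * ((1 - q ^ (2 * (N - M))) * C M + D M)
      + ((1 + q ^ (2 * N + 1)) * (wt q N M * b M)
      + q powi (int N + 1 - A) * (wt q N M * (q ^ (N - M) * cbin q M (A - 1)))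
      + q powi (int N + 2 + A) * (wt q N M * (q ^ (N - M) * cbin q M (A + 2))))"
      unfolding b C_def D_def e e2 by algebra
  qed
  also have "\<dots> = (1 + q ^ (2 * N + 1)) * U N A q
           + q powi (int N + 1 - A) * T1 N (A - 1) q + q powi (int N + 2 + A) * T1 N (A + 2) q"
    unfolding sum.distrib zero by (simp only: U_conv_wt T1_def b_def sum_distrib_left) simp
  finally show ?thesis .
qed

section \<open>Alternating sums over the integers\<close>

lemma Sum_any_telescope:
  fixes F G h :: "int \<Rightarrow> 'a::field"
  assumes F: "finite {j. F j \<noteq> 0}" and h: "finite {j. h j \<noteq> 0}"
    and G: "\<And>j. G j = c * F j + (h j - h (j - 1))"
  shows "Sum_any G = c * Sum_any F"
proof -
  have h': "finite {j. - h (j - 1) \<noteq> 0}"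
  proof -
    have "{j. - h (j - 1) \<noteq> 0} = (\<lambda>j. j + 1) ` {j. h j \<noteq> 0}"
      by (force simp: image_iff intro: exI[of _ "_ - 1"])
    then show ?thesis using h by simp
  qed
  have cF: "finite {j. c * F j \<noteq> 0}"
    by (rule finite_subset[OF _ F]) auto
  have sub: "finite {j. h j + - h (j - 1) \<noteq> 0}"
    by (rule finite_subset[OF _ finite_UnI[OF h h']]) auto
  have "Sum_any (\<lambda>j. - h (j - 1)) = Sum_any (\<lambda>j. - h j)"
    by (rule Sum_any.reindex_cong[of "\<lambda>j. j + 1"])
       (auto simp: o_def inj_on_def bij_def surj_def intro: exI[of _ "_ - 1"])
  also have "\<dots> = - Sum_any h"
    by (simp add: Sum_any.expand_set sum_negf)
  finally have neg: "Sum_any (\<lambda>j. - h (j - 1)) = - Sum_any h" .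
  have "G = (\<lambda>j. c * F j + (h j + - h (j - 1)))"
    by (rule ext) (simp add: G)
  then have "Sum_any G = Sum_any (\<lambda>j. c * F j) + (Sum_any h + Sum_any (\<lambda>j. - h (j - 1)))"
    by (simp only: Sum_any.distrib[OF cF sub] Sum_any.distrib[OF h h'])
  also have "\<dots> = c * Sum_any F"
    by (simp add: neg Sum_any_right_distrib[OF F])
  finally show ?thesis .
qed

lemma finite_support_bounded:
  fixes f :: "int \<Rightarrow> 'a::zero"
  assumes "\<And>j. \<bar>j\<bar> > B \<Longrightarrow> f j = 0"
  shows "finite {j. f j \<noteq> 0}"
  by (rule finite_subset[of _ "{-B..B}"]) (use assms in force)+

lemma Sum_any_single:
  assumes "\<And>j. j \<noteq> a \<Longrightarrow> f j = 0"
  shows "Sum_any f = f a"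
proof -
  have "Sum_any f = sum f {a}"
    by (rule Sum_any.expand_superset) (use assms in auto)
  then show ?thesis by simp
qed

lemma minus_one_powi_pred: "(-1) powi (j - 1) = - ((-1) powi j :: 'a::field)"
  by (simp add: power_int_diff)

text \<open>
  In the next two families, the choice of \<open>h\<close> in the recurrence is forced: \<open>h j\<close> is the extra term with
  the shift upwards (to \<open>2j + 1\<close>, respectively \<open>3j + 2\<close>), and completing the square shows that the extra
  term with the shift downwards is \<open>- h (j - 1)\<close>.
\<close>

definition alt_sum :: "nat \<Rightarrow> 'a::field \<Rightarrow> 'a" where
  "alt_sum n q = Sum_any (\<lambda>j::int. (-1) powi j * q powi (2 * j ^ 2) * cbin q n (2 * j))"

definition U_sum :: "nat \<Rightarrow> 'a::field \<Rightarrow> 'a" where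
  "U_sum n q = Sum_any (\<lambda>j::int. (-1) powi j * q powi (3 * j ^ 2 + j) * U n (3 * j) q)"

lemma alt_sum_0: "alt_sum 0 q = 1"
proof -
  have "alt_sum 0 q = (-1) powi 0 * q powi (2 * 0 ^ 2) * cbin q 0 (2 * 0)"
    unfolding alt_sum_def by (rule Sum_any_single) (simp add: cbin_0)
  then show ?thesis by (simp add: cbin_0)
qed

lemma U_sum_0: "U_sum 0 q = 1"
proof -
  have U0: "U 0 A q = (if A = 0 \<or> A = - 1 then 1 else 0)" for A
    by (auto simp: U_conv_wt cbin_0 wt_def gauss_zero)
  (* The second nonzero value of U 0, at -1, is missed by the multiples of 3. *)
  have "3 * j \<noteq> - 1" for j :: int
    by presburger
  then have "U_sum 0 q = (-1) powi 0 * q powi (3 * 0 ^ 2 + 0) * U 0 (3 * 0) q"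
    unfolding U_sum_def by (intro Sum_any_single) (simp add: U0)
  then show ?thesis by (simp add: U0)
qed

lemma alt_sum_Suc:
  assumes "generic q"
  shows "alt_sum (Suc n) q = (1 + q ^ (2 * n + 1)) * alt_sum n q"
  unfolding alt_sum_def
proof (rule Sum_any_telescope)
  define h where "h = (\<lambda>j. (-1) powi j * q powi (2 * j\<^sup>2 + 2 * j + int n + 1) * cbin q n (2 * j + 1))"
  show "finite {j. (-1) powi j * q powi (2 * j ^ 2) * cbin q n (2 * j) \<noteq> 0}"
    by (rule finite_support_bounded[of "int n"]) (simp add: cbin_eq_0)
  show "finite {j. h j \<noteq> 0}"
    by (rule finite_support_bounded[of "int n + 1"]) (simp add: h_def cbin_eq_0)
  fix j :: int
  have q: "q \<noteq> 0" using assms by (simp add: generic_def)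
  have e: "q powi (2 * j\<^sup>2) * q powi (int n + 1 + 2 * j) = q powi (2 * j\<^sup>2 + 2 * j + int n + 1)"
    "q powi (2 * j\<^sup>2) * q powi (int n + 1 - 2 * j) = q powi (2 * (j-1)\<^sup>2 + 2 * (j-1) + int n + 1)"
    using q by (simp_all add: algebra_simps power2_eq_square flip: power_int_add)
  have s: "2 * (j - 1) + 1 = 2 * j - 1" by simp
  show "(-1) powi j * q powi (2 * j ^ 2) * cbin q (Suc n) (2 * j)
      = (1 + q ^ (2 * n + 1)) * ((-1) powi j * q powi (2 * j ^ 2) * cbin q n (2 * j))
        + (h j - h (j - 1))"
    unfolding h_def minus_one_powi_pred cbin_Suc[OF assms] e[symmetric] s
    by algebra
qed

lemma U_sum_Suc:
  assumes "generic q"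
  shows "U_sum (Suc n) q = (1 + q ^ (2 * n + 1)) * U_sum n q"
  unfolding U_sum_def
proof (rule Sum_any_telescope)
  define h where "h = (\<lambda>j. (-1) powi j * q powi (3 * j\<^sup>2 + 4 * j + int n + 2) * T1 n (3 * j + 2) q)"
  show "finite {j. (-1) powi j * q powi (3 * j ^ 2 + j) * U n (3 * j) q \<noteq> 0}"
    by (rule finite_support_bounded[of "int n + 1"]) (simp add: U_def T0_eq_0)
  show "finite {j. h j \<noteq> 0}"
    by (rule finite_support_bounded[of "int n + 2"]) (simp add: h_def T1_eq_0)
  fix j :: int
  have q: "q \<noteq> 0" using assms by (simp add: generic_def)
  have e: "q powi (3 * j\<^sup>2 + j) * q powi (int n + 2 + 3 * j) = q powi (3 * j\<^sup>2 + 4 * j + int n + 2)"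
    "q powi (3 * j\<^sup>2 + j) * q powi (int n + 1 - 3 * j)
      = q powi (3 * (j - 1)\<^sup>2 + 4 * (j - 1) + int n + 2)"
    using q by (simp_all add: algebra_simps power2_eq_square flip: power_int_add)
  have s: "3 * (j - 1) + 2 = 3 * j - 1" by simp
  show "(-1) powi j * q powi (3 * j ^ 2 + j) * U (Suc n) (3 * j) q
      = (1 + q ^ (2 * n + 1)) * ((-1) powi j * q powi (3 * j ^ 2 + j) * U n (3 * j) q)
        + (h j - h (j - 1))"
    unfolding h_def minus_one_powi_pred U_Suc[OF assms] e[symmetric] s
    by algebra
qed

section \<open>The sum P and the product\<close>

lemma P_conv_sum: "P n q = (\<Sum>j\<le>n. q ^ (j ^ 2) * gauss (q ^ 2) (int n) (int j))"
  unfolding P_def by (rule Sum_any.expand_superset) (auto simp: gauss_def intro: leI)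

lemma P_0: "P 0 q = 1"
  by (simp add: P_conv_sum gauss_zero)

text \<open>
  The Pascal rule in base \<open>q\<^sup>2\<close> contributes \<open>q\<^bsup>2(n-j)\<^esup>\<close> at the index \<open>j + 1\<close>, and
  \<open>(j + 1)\<^sup>2 + 2(n - j) = j\<^sup>2 + 2n + 1\<close> makes the second term a constant multiple of the old summand.
\<close>

lemma P_Suc:
  assumes "generic q"
  shows "P (Suc n) q = (1 + q ^ (2 * n + 1)) * P n q"
proof -
  define F where "F = (\<lambda>n j. q ^ (j ^ 2) * gauss (q ^ 2) (int n) (int j))"
  have q: "q \<noteq> 0" using assms by (simp add: generic_def)
  have P: "P m q = (\<Sum>j\<le>m. F m j)" for m
    by (simp add: P_conv_sum F_def)
  have rec0: "F (Suc n) 0 = F n 0"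
    using gauss_pascal'[OF generic_square[OF assms], of "int (Suc n)" 0]
    by (simp add: F_def gauss_def[of _ _ "-1"])
  have rec: "F (Suc n) (Suc j) = F n (Suc j) + q ^ (2 * n + 1) * F n j" for j
  proof -
    have "q ^ ((Suc j)\<^sup>2) * (q ^ 2) powi (int n - int j) = q ^ (2 * n + 1) * q ^ (j\<^sup>2)"
      using q unfolding powi_square
      by (simp add: power2_eq_square algebra_simps flip: power_int_add power_int_of_nat)
    then show ?thesis
      using gauss_pascal'[OF generic_square[OF assms], of "int (Suc n)" "int (Suc j)"]
      by (simp add: F_def distrib_left flip: mult.assoc)
  qed
  have "P (Suc n) q = F n 0 + (\<Sum>j\<le>n. F n (Suc j)) + q ^ (2 * n + 1) * (\<Sum>j\<le>n. F n j)"
    unfolding P sum.atMost_Suc_shift rec0 rec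
    by (simp only: sum.distrib sum_distrib_left add.assoc)
  also have "F n 0 + (\<Sum>j\<le>n. F n (Suc j)) = (\<Sum>j\<le>Suc n. F n j)"
    unfolding sum.atMost_Suc_shift ..
  also have "\<dots> = (\<Sum>j\<le>n. F n j)"
    by (simp add: F_def gauss_def)
  finally show ?thesis
    by (simp add: P algebra_simps)
qed

lemma qpoch_neg_Suc:
  "qpoch (- q) (q ^ 2) (Suc n) = (1 + q ^ (2 * n + 1)) * qpoch (- q) (q ^ 2) n"
  by (simp add: qpoch_def mult.commute flip: power_mult)

theorem mainTheorem2:
  shows "(\<forall>n::nat.
            P n qq = Sum_any (\<lambda>j::int. (-1) powi j * qq powi (2 * j ^ 2)
                                        * gauss qq (2 * int n) (int n + 2 * j))
          \<and> P n qq = Sum_any (\<lambda>j::int. (-1) powi j * qq powi (3 * j ^ 2 + j) * U n (3 * j) qq)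
          \<and> P n qq = qpoch (- qq) (qq ^ 2) n)
       \<and> P 0 qq = 1
       \<and> (\<forall>n\<ge>1. P n qq = (1 + qq ^ (2 * n - 1)) * P (n - 1) qq)"
proof (intro conjI allI impI)
  fix n :: nat
  show "P n qq = Sum_any (\<lambda>j::int. (-1) powi j * qq powi (2 * j ^ 2)
                                        * gauss qq (2 * int n) (int n + 2 * j))"
    unfolding cbin_def[symmetric] alt_sum_def[symmetric]
    by (induction n) (simp_all only: P_0 alt_sum_0 P_Suc[OF generic_qq] alt_sum_Suc[OF generic_qq])
  show "P n qq = Sum_any (\<lambda>j::int. (-1) powi j * qq powi (3 * j ^ 2 + j) * U n (3 * j) qq)"
    unfolding U_sum_def[symmetric]
    by (induction n) (simp_all only: P_0 U_sum_0 P_Suc[OF generic_qq] U_sum_Suc[OF generic_qq])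
  show "P n qq = qpoch (- qq) (qq ^ 2) n"
    by (induction n) (simp add: P_0 qpoch_def,
        simp only: P_Suc[OF generic_qq] qpoch_neg_Suc)
  show "P n qq = (1 + qq ^ (2 * n - 1)) * P (n - 1) qq" if "1 \<le> n"
    using that P_Suc[OF generic_qq, of "n - 1"] by (cases n) simp_all
qed (rule P_0)

end
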